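(* Let $K>0$ and $N>1$. If a quantum Markov semigroup $(P_t)_{t\ge0}$ on $\mathcal{M}$ satisfies $\mathrm{BE}(K,N)$ and $\lambda_1$ is the smallest non-zero eigenvalue of its generator $\mathcal{L}$, then $$\lambda_1\ge\frac{KN}{N-1}.$$
   Context: $\mathcal{M}$ is a finite-dimensional von Neumann algebra with faithful tracial state $\tau$. $|x|^2=x^*x$. Inequalities between self-adjoint elements are in the usual operator order. A quantum Markov semigroup on $\mathcal M$ is a family $(P_t)_{t\ge0}$ of linear maps on $\mathcal{M}$ with $P_0=\mathrm{id}$, $P_{s+t}=P_sP_t$, each $P_t$ completely positive and unital, and $t\mapsto P_t$ continuous. Its generator is $\mathcal{L}x=\lim_{t\searrow0}\frac1t(x-P_tx)$, so $P_t=e^{-t\mathcal{L}}$. $\Gamma(a,b)=\frac12\big(a^*\mathcal{L}b+(\mathcal{L}a)^*b-\mathcal{L}(a^*b)\big)$, $\Gamma_2(a,b)=\frac12\big(\Gamma(a,\mathcal{L}b)+\Gamma(\mathcal{L}a,b)-\mathcal{L}\Gamma(a,b)\big)$, $\Gamma(a)=\Gamma(a,a)$, $\Gamma_2(a)=\Gamma_2(a,a)$. $(P_t)$ satisfies $\mathrm{BE}(K,N)$ if $\Gamma_2(a)\ge K\Gamma(a)+\frac1N|\mathcal{L}a|^2$ for all $a\in\mathcal{M}$; equivalently, $\Gamma(P_ta)\le e^{-2Kt}P_t\Gamma(a)-\frac{1-e^{-2Kt}}{KN}|\mathcal{L}P_ta|^2$ for all $t\ge0$, $a\in\mathcal{M}$.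 *)

theory Defs
  imports "HOL-Analysis.Analysis"
begin

section \<open>Finite-dimensional von Neumann algebras\<close>

text \<open>
  A finite-dimensional von Neumann algebra is represented as a von Neumann algebra of operators on
  the Hilbert space \<open>complex ^ 'n\<close>. The library's inner product on this type is the real one, so
  the sesquilinear one (linear in the second argument) is defined here.
\<close>

definition cinner :: "complex ^ 'n \<Rightarrow> complex ^ 'n \<Rightarrow> complex" where
  "cinner v w = (\<Sum>i\<in>UNIV. cnj (v $ i) * w $ i)"

definition cscale :: "complex \<Rightarrow> complex ^ 'n ^ 'n \<Rightarrow> complex ^ 'n ^ 'n" where
  "cscale c x = map_matrix (\<lambda>z. c * z) x"

definition adj :: "complex ^ 'n ^ 'n \<Rightarrow> complex ^ 'n ^ 'n" where
  "adj x = map_matrix cnj (transpose x)"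

text \<open>On a finite-dimensional space the weak operator topology is the topology of the type.\<close>

definition von_neumann_algebra :: "(complex ^ 'n ^ 'n) set \<Rightarrow> bool" where
  "von_neumann_algebra M \<longleftrightarrow>
     mat 1 \<in> M \<and>
     (\<forall>x\<in>M. \<forall>y\<in>M. x + y \<in> M) \<and>
     (\<forall>c. \<forall>x\<in>M. cscale c x \<in> M) \<and>
     (\<forall>x\<in>M. \<forall>y\<in>M. x ** y \<in> M) \<and>
     (\<forall>x\<in>M. adj x \<in> M) \<and>
     closed M"

definition pos_op :: "complex ^ 'n ^ 'n \<Rightarrow> bool" where
  "pos_op x \<longleftrightarrow> (\<forall>v. cinner v (x *v v) \<in> \<real>\<^sub>\<ge>\<^sub>0)"

definition op_le :: "complex ^ 'n ^ 'n \<Rightarrow> complex ^ 'n ^ 'n \<Rightarrow> bool"  (infix "\<preceq>" 50) where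
  "x \<preceq> y \<longleftrightarrow> pos_op (y - x)"

definition abs_sq :: "complex ^ 'n ^ 'n \<Rightarrow> complex ^ 'n ^ 'n" where
  "abs_sq x = adj x ** x"

definition linear_on_algebra ::
    "(complex ^ 'n ^ 'n) set \<Rightarrow> (complex ^ 'n ^ 'n \<Rightarrow> complex ^ 'n ^ 'n) \<Rightarrow> bool" where
  "linear_on_algebra M T \<longleftrightarrow>
     (\<forall>x\<in>M. T x \<in> M) \<and>
     (\<forall>x\<in>M. \<forall>y\<in>M. T (x + y) = T x + T y) \<and>
     (\<forall>c. \<forall>x\<in>M. T (cscale c x) = cscale c (T x))"

definition faithful_tracial_state ::
    "(complex ^ 'n ^ 'n) set \<Rightarrow> (complex ^ 'n ^ 'n \<Rightarrow> complex) \<Rightarrow> bool" where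
  "faithful_tracial_state M \<tau> \<longleftrightarrow>
     (\<forall>x\<in>M. \<forall>y\<in>M. \<tau> (x + y) = \<tau> x + \<tau> y) \<and>
     (\<forall>c. \<forall>x\<in>M. \<tau> (cscale c x) = c * \<tau> x) \<and>
     (\<forall>x\<in>M. \<tau> (abs_sq x) \<in> \<real>\<^sub>\<ge>\<^sub>0) \<and>
     \<tau> (mat 1) = 1 \<and>
     (\<forall>x\<in>M. \<forall>y\<in>M. \<tau> (x ** y) = \<tau> (y ** x)) \<and>
     (\<forall>x\<in>M. \<tau> (abs_sq x) = 0 \<longrightarrow> x = 0)"

section \<open>Quantum Markov semigroups\<close>

text \<open>
  Positivity of the \<open>k \<times> k\<close> operator matrix with entries \<open>A i j\<close> for \<open>i, j < k\<close>, acting on the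
  \<open>k\<close>-fold direct sum of \<open>complex ^ 'n\<close>.
\<close>

definition pos_block :: "nat \<Rightarrow> (nat \<Rightarrow> nat \<Rightarrow> complex ^ 'n ^ 'n) \<Rightarrow> bool" where
  "pos_block k A \<longleftrightarrow>
     (\<forall>\<xi>. (\<Sum>i<k. \<Sum>j<k. cinner (\<xi> i) (A i j *v \<xi> j)) \<in> \<real>\<^sub>\<ge>\<^sub>0)"

definition completely_positive ::
    "(complex ^ 'n ^ 'n) set \<Rightarrow> (complex ^ 'n ^ 'n \<Rightarrow> complex ^ 'n ^ 'n) \<Rightarrow> bool" where
  "completely_positive M T \<longleftrightarrow>
     (\<forall>k A. (\<forall>i<k. \<forall>j<k. A i j \<in> M) \<longrightarrow> pos_block k A \<longrightarrow> pos_block k (\<lambda>i j. T (A i j)))"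

text \<open>
  Only times \<open>t \<ge> 0\<close> and arguments in \<open>M\<close> matter. As \<open>M\<close> is finite-dimensional, pointwise
  continuity of \<open>t \<mapsto> P t\<close> is continuity in norm.
\<close>

definition quantum_markov_semigroup ::
    "(complex ^ 'n ^ 'n) set \<Rightarrow> (real \<Rightarrow> complex ^ 'n ^ 'n \<Rightarrow> complex ^ 'n ^ 'n) \<Rightarrow> bool" where
  "quantum_markov_semigroup M P \<longleftrightarrow>
     (\<forall>t\<ge>0. linear_on_algebra M (P t)) \<and>
     (\<forall>x\<in>M. P 0 x = x) \<and>
     (\<forall>s\<ge>0. \<forall>t\<ge>0. \<forall>x\<in>M. P (s + t) x = P s (P t x)) \<and>
     (\<forall>t\<ge>0. completely_positive M (P t)) \<and>
     (\<forall>t\<ge>0. P t (mat 1) = mat 1) \<and>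
     (\<forall>x\<in>M. continuous_on {0..} (\<lambda>t. P t x))"

definition generator ::
    "(real \<Rightarrow> complex ^ 'n ^ 'n \<Rightarrow> complex ^ 'n ^ 'n) \<Rightarrow> complex ^ 'n ^ 'n \<Rightarrow> complex ^ 'n ^ 'n" where
  "generator P x = Lim (at_right 0) (\<lambda>t. (1 / t) *\<^sub>R (x - P t x))"

definition eigenvalue ::
    "(complex ^ 'n ^ 'n) set \<Rightarrow> (complex ^ 'n ^ 'n \<Rightarrow> complex ^ 'n ^ 'n) \<Rightarrow> complex \<Rightarrow> bool" where
  "eigenvalue M T \<mu> \<longleftrightarrow> (\<exists>x\<in>M. x \<noteq> 0 \<and> T x = cscale \<mu> x)"

text \<open>
  No symmetry of the semigroup is assumed, so its generator may have non-real eigenvalues. Hence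
  eigenvalues are compared by their real parts, which is the order of the reals whenever the
  spectrum is real.
\<close>

definition smallest_nonzero_eigenvalue ::
    "(complex ^ 'n ^ 'n) set \<Rightarrow> (complex ^ 'n ^ 'n \<Rightarrow> complex ^ 'n ^ 'n) \<Rightarrow> complex \<Rightarrow> bool" where
  "smallest_nonzero_eigenvalue M T \<nu> \<longleftrightarrow>
     eigenvalue M T \<nu> \<and> \<nu> \<noteq> 0 \<and> (\<forall>\<mu>. eigenvalue M T \<mu> \<and> \<mu> \<noteq> 0 \<longrightarrow> Re \<nu> \<le> Re \<mu>)"

section \<open>The Bakry--Emery condition\<close>

definition Gam ::
    "(complex ^ 'n ^ 'n \<Rightarrow> complex ^ 'n ^ 'n) \<Rightarrow>
     complex ^ 'n ^ 'n \<Rightarrow> complex ^ 'n ^ 'n \<Rightarrow> complex ^ 'n ^ 'n" where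
  "Gam L a b = (1 / 2) *\<^sub>R (adj a ** L b + adj (L a) ** b - L (adj a ** b))"

definition Gam2 ::
    "(complex ^ 'n ^ 'n \<Rightarrow> complex ^ 'n ^ 'n) \<Rightarrow>
     complex ^ 'n ^ 'n \<Rightarrow> complex ^ 'n ^ 'n \<Rightarrow> complex ^ 'n ^ 'n" where
  "Gam2 L a b = (1 / 2) *\<^sub>R (Gam L a (L b) + Gam L (L a) b - L (Gam L a b))"

definition BE ::
    "(complex ^ 'n ^ 'n) set \<Rightarrow> (real \<Rightarrow> complex ^ 'n ^ 'n \<Rightarrow> complex ^ 'n ^ 'n) \<Rightarrow>
     real \<Rightarrow> real \<Rightarrow> bool" where
  "BE M P K N \<longleftrightarrow>
     (let L = generator P in
       \<forall>a\<in>M. K *\<^sub>R Gam L a a + (1 / N) *\<^sub>R abs_sq (L a) \<preceq> Gam2 L a a)"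

end

theory Submission
  imports Defs
begin

text \<open>
  Let \<open>\<L> a = \<mu> a\<close> with \<open>\<mu> \<noteq> 0\<close>, and put \<open>b = a\<^sup>* a\<close>, \<open>g = \<Gamma>(a)\<close>, \<open>r = Re \<mu>\<close>, \<open>c = \<bar>\<mu>\<bar>\<^sup>2 / N\<close>. Then
  \<open>\<L> b = 2 (r b - g)\<close>, and the Bakry--Emery condition at \<open>a\<close> reads
  \<open>\<L> g \<le> 2 ((r - K) g - c b)\<close>. Integrating against an invariant state need not detect \<open>a\<close>, because
  such a state need not be faithful. Instead let \<open>m > K\<close> be the positive root of \<open>m (m - K) = c\<close>;
  then \<open>w = g + (m - K) b\<close> is positive, non-zero and satisfies \<open>\<L> w \<le> 2 (r - m) w\<close>. At a unit
  vector \<open>v\<close> maximizing \<open>\<langle>v, w v\<rangle>\<close> the maximum principle gives \<open>\<langle>v, \<L> w v\<rangle> \<ge> 0\<close>, whence \<open>r \<ge> m\<close>.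
  So \<open>r (r - K) \<ge> c \<ge> r\<^sup>2 / N\<close>, which is the claim.
\<close>

subsection \<open>Differentiability of continuous semigroups\<close>

text \<open>Links derivatives from the fundamental theorem of calculus to the one-sided quotient in
  \<open>generator\<close>.\<close>

lemma right_difference_quotient:
  fixes f :: "real \<Rightarrow> 'a::real_normed_vector"
  assumes "(f has_vector_derivative l) (at_right 0)"
  shows "((\<lambda>t. (1 / t) *\<^sub>R (f t - f 0)) \<longlongrightarrow> l) (at_right 0)"
proof -
  have "((\<lambda>t. (1 / norm (t - 0)) *\<^sub>R (f t - (f 0 + (t - 0) *\<^sub>R l))) \<longlongrightarrow> 0) (at_right 0)"
    using assms unfolding has_vector_derivative_def has_derivative_within by auto
  moreover have "eventually (\<lambda>t. (1 / norm (t - 0)) *\<^sub>R (f t - (f 0 + (t - 0) *\<^sub>R l))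
      = (1 / t) *\<^sub>R (f t - f 0) - l) (at_right 0)"
    using eventually_at_right_less[of 0]
    by eventually_elim (simp add: algebra_simps)
  ultimately have "((\<lambda>t. (1 / t) *\<^sub>R (f t - f 0) - l) \<longlongrightarrow> 0) (at_right 0)"
    using tendsto_cong by force
  then show ?thesis
    by (simp add: LIM_zero_iff)
qed

lemma continuous_semigroup_differentiable:
  fixes V :: "'a::euclidean_space set" and P :: "real \<Rightarrow> 'a \<Rightarrow> 'a"
  assumes V: "subspace V"
    and inV: "\<And>t x. t \<ge> 0 \<Longrightarrow> x \<in> V \<Longrightarrow> P t x \<in> V"
    and add: "\<And>t x y. t \<ge> 0 \<Longrightarrow> x \<in> V \<Longrightarrow> y \<in> V \<Longrightarrow> P t (x + y) = P t x + P t y"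
    and scale: "\<And>t c x. t \<ge> 0 \<Longrightarrow> x \<in> V \<Longrightarrow> P t (c *\<^sub>R x) = c *\<^sub>R P t x"
    and P0: "\<And>x. x \<in> V \<Longrightarrow> P 0 x = x"
    and Padd: "\<And>s t x. s \<ge> 0 \<Longrightarrow> t \<ge> 0 \<Longrightarrow> x \<in> V \<Longrightarrow> P (s + t) x = P s (P t x)"
    and cont: "\<And>x. x \<in> V \<Longrightarrow> continuous_on {0..} (\<lambda>t. P t x)"
    and x: "x \<in> V"
  shows "\<exists>l. ((\<lambda>t. (1 / t) *\<^sub>R (P t x - x)) \<longlongrightarrow> l) (at_right 0)"
  \<comment> \<open>For small \<open>d > 0\<close> every \<open>x\<close> in \<open>V\<close> is of the form \<open>\<integral>\<^sub>0\<^sup>d P s y ds\<close>, where the difference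
    quotient converges by the fundamental theorem of calculus.\<close>
proof -
  obtain B where B: "B \<subseteq> V" "pairwise orthogonal B" "\<And>b. b \<in> B \<Longrightarrow> norm b = 1"
    "independent B" "card B = dim V" "span B = V"
    using orthonormal_basis_subspace[OF V] by metis
  have fin: "finite B" using B(4) by (rule independent_imp_finite)
  have expand: "(\<Sum>b\<in>B. (x \<bullet> b) *\<^sub>R b) = x" if "x \<in> V" for x
    using orthonormal_basis_expand[of B x] B fin that by auto
  have Psum: "P t (\<Sum>b\<in>C. c b *\<^sub>R b) = (\<Sum>b\<in>C. c b *\<^sub>R P t b)"
    if "t \<ge> 0" "finite C" "C \<subseteq> B" for t c C
    using that(2,3)
  proof (induction C)
    case empty
    \<comment> \<open>Homogeneity with factor 0 shows that \<open>P t\<close> sends 0 to 0.\<close>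
    show ?case using scale[OF that(1) x, of 0] by (simp only: sum.empty scaleR_zero_left)
  next
    case (insert a C)
    have "(\<Sum>b\<in>C. c b *\<^sub>R b) \<in> V" "a \<in> V"
      using insert B(1) V by (auto intro!: subspace_sum subspace_scale)
    then show ?case
      using insert that(1) V by (simp add: add scale subspace_scale)
  qed
  \<comment> \<open>\<open>P t\<close> composed with the orthogonal projection onto \<open>V\<close>: linear on the whole space\<close>
  define T where "T t y = (\<Sum>b\<in>B. (y \<bullet> b) *\<^sub>R P t b)" for t y
  have TP: "T t y = P t y" if "t \<ge> 0" "y \<in> V" for t y
    using Psum[OF that(1) fin order.refl, of "\<lambda>b. y \<bullet> b"] expand[OF that(2)] by (simp add: T_def)
  have linT: "bounded_linear (T t)" for t
    unfolding T_def by (intro bounded_linear_intros)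
  have TV: "T t y \<in> V" if "t \<ge> 0" for t y
    unfolding T_def using that B(1) by (auto intro!: subspace_sum subspace_scale V inV)
  have contT: "continuous_on {0..} (\<lambda>t. T t y)" for y
    unfolding T_def using B(1) by (auto intro!: continuous_intros cont)
  have int: "(\<lambda>t. T t y) integrable_on {a..b}" if "a \<ge> 0" for a b y
    using that by (intro integrable_continuous_real continuous_on_subset[OF contT]) auto
  \<comment> \<open>\<open>D s\<close> bounds the operator norm of \<open>P s\<close> minus the
    identity on \<open>V\<close>; continuity makes it small near 0.\<close>
  define D where "D s = (\<Sum>b\<in>B. norm (P s b - b))" for s
  have "continuous_on {0..} D"
    unfolding D_def using B(1) by (auto intro!: continuous_intros cont)
  moreover have "D 0 = 0"
    unfolding D_def using B(1) P0 by (auto intro!: sum.neutral)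
  ultimately obtain e where e: "e > 0" "\<And>s. s \<ge> 0 \<Longrightarrow> s < e \<Longrightarrow> \<bar>D s\<bar> < 1/2"
    unfolding continuous_on_iff dist_real_def
    by (metis atLeast_iff diff_zero abs_of_nonneg order.refl half_gt_zero zero_less_one)
  \<comment> \<open>Half of \<open>e\<close>, so that the closed interval from 0 to \<open>d\<close>
    stays where \<open>D\<close> is below 1/2.\<close>
  define d where "d = e / 2"
  have d: "d > 0" using e by (simp add: d_def)
  have close: "norm (T s y - y) \<le> 1/2 * norm y" if "s \<in> {0..d}" "y \<in> V" for s y
  proof -
    have "T s y - y = (\<Sum>b\<in>B. (y \<bullet> b) *\<^sub>R (P s b - b))"
      using expand[OF that(2)] by (simp add: T_def scaleR_diff_right sum_subtractf)
    also have "norm \<dots> \<le> (\<Sum>b\<in>B. norm y * norm (P s b - b))"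
    proof (rule order.trans[OF norm_sum], rule sum_mono)
      fix b assume "b \<in> B"
      then have "\<bar>y \<bullet> b\<bar> \<le> norm y"
        using Cauchy_Schwarz_ineq2[of y b] B(3) by simp
      then show "norm ((y \<bullet> b) *\<^sub>R (P s b - b)) \<le> norm y * norm (P s b - b)"
        by (simp add: mult_right_mono)
    qed
    also have "\<dots> = norm y * D s" by (simp add: D_def sum_distrib_left)
    also have "\<dots> \<le> norm y * (1/2)"
      using e(2)[of s] e(1) that(1) by (intro mult_left_mono) (auto simp: d_def)
    finally show ?thesis by simp
  qed
  define J where "J y = integral {0..d} (\<lambda>s. T s y)" for y
  have linJ: "linear J"
  proof (rule linearI)
    show "J (y + z) = J y + J z" for y z
      unfolding J_def using int
      by (simp add: bounded_linear.linear[OF linT] linear_add integral_add)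
    show "J (c *\<^sub>R y) = c *\<^sub>R J y" for c y
      unfolding J_def by (simp add: bounded_linear.linear[OF linT] linear_cmul)
  qed
  have JV: "J y \<in> V" for y
  proof -
    \<comment> \<open>\<open>T 0\<close> is the orthogonal projection onto \<open>V\<close>. It
      commutes with the integral and fixes the integrand, hence fixes \<open>J y\<close>.\<close>
    have pr: "T 0 z = z" if "z \<in> V" for z using TP[of 0 z] P0 that by simp
    have "integral {0..d} (T 0 \<circ> (\<lambda>s. T s y)) = T 0 (J y)"
      unfolding J_def using int linT by (intro integral_linear) auto
    moreover have "integral {0..d} (T 0 \<circ> (\<lambda>s. T s y)) = J y"
      unfolding J_def by (rule integral_cong) (simp add: pr TV)
    ultimately show ?thesis using TV[of 0 "J y"] by simp
  qed
  have J0: "y = 0" if "y \<in> V" "J y = 0" for y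
  proof -
    \<comment> \<open>By \<open>close\<close>, \<open>J y\<close> differs from \<open>d\<close>
      times \<open>y\<close> by at most half the norm of the latter, so it vanishes only for
      \<open>y = 0\<close>.\<close>
    have "integral {0..d} (\<lambda>s. T s y - y) = J y - d *\<^sub>R y"
      unfolding J_def using int d by (subst integral_diff) auto
    moreover have "norm (integral {0..d} (\<lambda>s. T s y - y)) \<le> 1/2 * norm y * (d - 0)"
      using d close that(1) contT
      by (intro integral_bound continuous_intros continuous_on_subset[OF contT]) auto
    ultimately have "d * norm y \<le> 1/2 * norm y * d" using that d by simp
    then show ?thesis using d by (simp add: field_simps)
  qed
  \<comment> \<open>In finite dimension the injective map \<open>J\<close> of \<open>V\<close> into
    itself is onto, so the given \<open>x\<close> is an integral over an orbit.\<close>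
  have "inj_on J V"
    using J0 linear_diff[OF linJ] subspace_diff[OF V]
    by (intro inj_onI) (metis right_minus_eq)
  then have "dim (J ` V) = dim V"
    using dim_image_eq[OF linJ, of V] V by (simp add: span_eq_iff[THEN iffD2])
  then have "J ` V = V"
    using JV by (intro subspace_dim_equal linear_subspace_image[OF linJ] V) auto
  then obtain y where y: "y \<in> V" "x = J y" using x by (metis imageE)
  define F where "F u = integral {0..u} (\<lambda>s. T s y)" for u
  \<comment> \<open>\<open>P t\<close> moves the window of integration from \<open>{0..d}\<close> to
    \<open>{t..d+t}\<close>; only the values of the primitive \<open>F\<close> at the endpoints
    remain.\<close>
  have Px: "P t x - x = F (d + t) - F t - F d" if "t \<ge> 0" for t
  proof -
    have "P t x = T t x" using TP x that by simp
    also have "\<dots> = integral {0..d} (T t \<circ> (\<lambda>s. T s y))"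
      unfolding y(2) J_def using int linT by (intro integral_linear[symmetric]) auto
    also have "\<dots> = integral {0..d} ((\<lambda>s. T s y) \<circ> (\<lambda>s. s + t))"
    proof (rule integral_cong)
      fix s assume "s \<in> {0..d}"
      then have "T t (T s y) = P (t + s) y" "P (t + s) y = T (t + s) y"
        using that y(1) by (simp_all add: TP inV Padd)
      then show "(T t \<circ> (\<lambda>s. T s y)) s = ((\<lambda>s. T s y) \<circ> (\<lambda>s. s + t)) s"
        by (simp add: add.commute)
    qed
    also have "\<dots> = integral {0+t..d+t} (\<lambda>s. T s y)"
      using that by (intro integral_shift continuous_on_subset[OF contT]) auto
    also have "\<dots> = F (d + t) - F t"
      unfolding F_def using that d
        Henstock_Kurzweil_Integration.integral_combine[of 0 t "d+t" "\<lambda>s. T s y"] int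
      by (simp add: algebra_simps)
    finally show ?thesis by (simp add: y(2) J_def F_def)
  qed
  \<comment> \<open>The interval reaches past \<open>d\<close>, leaving room for a right derivative
    at \<open>d\<close>.\<close>
  have F': "(F has_vector_derivative T u y) (at u within {0..d+1})" if "u \<in> {0..d+1}" for u
    unfolding F_def using that
    by (intro integral_has_vector_derivative continuous_on_subset[OF contT]) auto
  have shift: "((\<lambda>t. F (d + t)) has_vector_derivative 1 *\<^sub>R T d y) (at 0 within {0..1})"
  proof -
    have "(F has_vector_derivative T d y) (at (d + 0) within (+) d ` {0..1})"
      using d by (auto intro!: has_vector_derivative_within_subset[OF F'])
    then show ?thesis
      by (intro vector_diff_chain_within[where f = "(+) d" and g = F, unfolded o_def])
        (auto intro!: derivative_eq_intros)
  qed
  moreover have "(F has_vector_derivative T 0 y) (at 0 within {0..1})"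
    using d by (auto intro!: has_vector_derivative_within_subset[OF F'])
  ultimately have "((\<lambda>t. F (d + t) - F t - F d) has_vector_derivative 1 *\<^sub>R T d y - T 0 y - 0)
      (at 0 within {0..1})"
    by (intro has_vector_derivative_diff has_vector_derivative_const)
  then have "((\<lambda>t. F (d + t) - F t - F d) has_vector_derivative 1 *\<^sub>R T d y - T 0 y - 0) (at_right 0)"
    by (simp add: at_within_Icc_at_right)
  from right_difference_quotient[OF this]
  have *: "((\<lambda>t. (1 / t) *\<^sub>R (F (d + t) - F t - F d)) \<longlongrightarrow> 1 *\<^sub>R T d y - T 0 y - 0) (at_right 0)"
    by (simp add: F_def)
  have "eventually (\<lambda>t. (1 / t) *\<^sub>R (F (d + t) - F t - F d) = (1 / t) *\<^sub>R (P t x - x)) (at_right 0)"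
    using eventually_at_right_less[of 0] by eventually_elim (simp add: Px)
  from tendsto_cong[OF this] * show ?thesis by auto
qed

subsection \<open>The sesquilinear inner product and the adjoint\<close>

lemma cinner_simps:
  "cinner v (x + y) = cinner v x + cinner v y"
  "cinner (x + y) v = cinner x v + cinner y v"
  "cinner v (x - y) = cinner v x - cinner v y"
  "cinner v (- y) = - cinner v y"
  "cinner (- x) v = - cinner x v"
  "cinner v (c *s x) = c * cinner v x"
  "cinner (c *s x) v = cnj c * cinner x v"
  unfolding cinner_def
  by (simp_all add: algebra_simps sum.distrib sum_subtractf sum_negf sum_distrib_left)

lemma cinner_self: "cinner v v = of_real ((norm v)\<^sup>2)"
  unfolding cinner_def norm_vec_def L2_set_def
  by (simp add: sum_nonneg complex_norm_square mult.commute del: of_real_power)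

lemma cnj_cinner: "cnj (cinner v w) = cinner w v"
  unfolding cinner_def by (simp add: mult.commute)

lemma cinner_adj: "cinner (x *v u) w = cinner u (adj x *v w)"
proof -
  have "cinner (x *v u) w = (\<Sum>i\<in>UNIV. \<Sum>j\<in>UNIV. cnj (x $ i $ j) * cnj (u $ j) * w $ i)"
    unfolding cinner_def matrix_vector_mult_def by (simp add: sum_distrib_right)
  also have "\<dots> = (\<Sum>j\<in>UNIV. \<Sum>i\<in>UNIV. cnj (x $ i $ j) * cnj (u $ j) * w $ i)"
    by (rule sum.swap)
  also have "\<dots> = cinner u (adj x *v w)"
    unfolding cinner_def matrix_vector_mult_def adj_def map_matrix_def transpose_def
    by (simp add: sum_distrib_left mult_ac)
  finally show ?thesis .
qed

lemma cinner_matrix_eqI: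
  assumes "\<And>u w. cinner u (x *v w) = cinner u (y *v w)"
  shows "x = y"
proof -
  \<comment> \<open>Testing against the difference itself makes its squared norm vanish.\<close>
  have "x *v w = y *v w" for w
    using assms[of "x *v w - y *v w" w] cinner_self[of "x *v w - y *v w"]
    by (simp add: cinner_simps)
  then show ?thesis by (simp add: matrix_eq)
qed

lemma cscale_simps:
  "a ** cscale c x = cscale c (a ** x)"
  "cscale c a ** x = cscale c (a ** x)"
  "adj (cscale c a) = cscale (cnj c) (adj a)"
  "cscale c (cscale d a) = cscale (c * d) a"
  "cscale c (x + y) = cscale c x + cscale c y"
  "cscale c (x - y) = cscale c x - cscale c y"
  "cscale c (t *\<^sub>R x) = t *\<^sub>R cscale c x"
  "cscale c x *v v = c *s (x *v v)"
  by (simp_all add: cscale_def map_matrix_def adj_def transpose_def matrix_matrix_mult_def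
      matrix_vector_mult_def vec_eq_iff sum_distrib_left algebra_simps)

lemma cscale_add_left: "cscale (c + d) x = cscale c x + cscale d x"
  by (simp add: cscale_def map_matrix_def vec_eq_iff algebra_simps)

lemma cscale_of_real: "cscale (of_real t) x = t *\<^sub>R x"
  by (simp add: cscale_def map_matrix_def vec_eq_iff scaleR_conv_of_real[where 'a = complex])

lemma cscale_minus_one: "cscale (- 1) x = - x"
  by (simp add: cscale_def map_matrix_def vec_eq_iff)

lemma scaleR_mult_vec: "(t *\<^sub>R x) *v v = complex_of_real t *s (x *v v)"
  by (simp add: matrix_vector_mult_def vec_eq_iff sum_distrib_left
      scaleR_conv_of_real[where 'a = complex] algebra_simps)

lemma diff_mult_vec: "(x - y) *v v = x *v v - y *v (v :: complex ^ 'n)"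
  by (simp add: matrix_vector_mult_diff_rdistrib)

lemmas form_simps = cinner_simps cscale_simps(8) scaleR_mult_vec diff_mult_vec
  matrix_vector_mult_add_rdistrib

lemma bounded_linear_form: "bounded_linear (\<lambda>x. cinner u (x *v v))"
proof -
  have "linear (\<lambda>x. cinner u (x *v v))"
    by (rule linearI) (simp_all add: form_simps scaleR_conv_of_real[where 'a = complex])
  then show ?thesis by (simp add: linear_conv_bounded_linear)
qed

lemma bounded_linear_cscale: "bounded_linear (cscale c)"
proof -
  have "linear (cscale c)"
    by (rule linearI) (simp_all add: cscale_simps)
  then show ?thesis by (simp add: linear_conv_bounded_linear)
qed

lemma bounded_linear_adj: "bounded_linear adj"
proof -
  have "linear adj"
    by (rule linearI) (simp_all add: adj_def map_matrix_def transpose_def vec_eq_iff)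
  then show ?thesis by (simp add: linear_conv_bounded_linear)
qed

text \<open>Compactness of the unit sphere gives a maximizer; homogeneity of degree 2 extends the
  bound to all \<open>u\<close>, as \<open>maximum_principle\<close> requires.\<close>

lemma form_attains_max:
  fixes x :: "complex ^ 'n ^ 'n"
  shows "\<exists>v. norm v = 1 \<and> (\<forall>u. Re (cinner u (x *v u)) \<le> Re (cinner v (x *v v)) * (norm u)\<^sup>2)"
proof -
  let ?f = "\<lambda>v. Re (cinner v (x *v v))"
  have "continuous_on (sphere 0 1) ?f"
    unfolding cinner_def matrix_vector_mult_def by (simp, intro continuous_intros)
  moreover have "sphere 0 1 \<noteq> ({} :: (complex ^ 'n) set)"
    by simp
  ultimately obtain v where v: "norm v = 1" "\<And>u. norm u = 1 \<Longrightarrow> ?f u \<le> ?f v"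
    using continuous_attains_sup[OF compact_sphere, of 0 1 ?f] by (auto simp: sphere_def)
  have "?f u \<le> ?f v * (norm u)\<^sup>2" for u
  proof (cases "u = 0")
    case True
    then show ?thesis by (simp add: cinner_def)
  next
    case False
    define s where "s = complex_of_real (norm u)"
    have u: "u = s *s sgn u"
      using False by (simp add: s_def sgn_div_norm vec_eq_iff scaleR_conv_of_real[where 'a = complex])
    have "x *v u = s *s (x *v sgn u)"
      by (subst u) (simp add: vector_scalar_commute)
    then have "cinner u (x *v u) = s * cinner u (x *v sgn u)"
      by (simp add: cinner_simps)
    also have "cinner u (x *v sgn u) = s * cinner (sgn u) (x *v sgn u)"
      by (subst (1) u) (simp add: cinner_simps s_def)
    finally have "?f u = (norm u)\<^sup>2 * ?f (sgn u)"
      by (simp add: s_def power2_eq_square)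
    also have "\<dots> \<le> (norm u)\<^sup>2 * ?f v"
      using v(2)[of "sgn u"] False by (simp add: norm_sgn mult_left_mono)
    finally show ?thesis by (simp add: mult.commute)
  qed
  with v(1) show ?thesis by blast
qed

subsection \<open>Generators of quantum Markov semigroups\<close>

locale qms =
  fixes M :: "(complex ^ 'n ^ 'n) set"
    and P :: "real \<Rightarrow> complex ^ 'n ^ 'n \<Rightarrow> complex ^ 'n ^ 'n"
  assumes vna: "von_neumann_algebra M"
    and qms: "quantum_markov_semigroup M P"
begin

abbreviation "L \<equiv> generator P"

lemma M_closed:
  "mat 1 \<in> M"
  "x \<in> M \<Longrightarrow> y \<in> M \<Longrightarrow> x + y \<in> M"
  "x \<in> M \<Longrightarrow> cscale c x \<in> M"
  "x \<in> M \<Longrightarrow> y \<in> M \<Longrightarrow> x ** y \<in> M"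
  "x \<in> M \<Longrightarrow> adj x \<in> M"
  using vna by (auto simp: von_neumann_algebra_def)

lemma M_scaleR: "x \<in> M \<Longrightarrow> t *\<^sub>R x \<in> M"
  using M_closed(3)[of x "of_real t"] by (simp add: cscale_of_real)

lemma M_diff: "x \<in> M \<Longrightarrow> y \<in> M \<Longrightarrow> x - y \<in> M"
  using M_closed(2)[of x "cscale (- 1) y"] M_closed(3)[of y "- 1"] by (simp add: cscale_minus_one)

lemma subspace_M: "subspace M"
  using M_scaleR[OF M_closed(1), of 0] by (auto simp: subspace_def M_closed(2) M_scaleR)

lemma P_linear:
  assumes "t \<ge> 0" "x \<in> M"
  shows "P t x \<in> M"
    and "y \<in> M \<Longrightarrow> P t (x + y) = P t x + P t y"
    and "P t (cscale c x) = cscale c (P t x)"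
    and "P t (r *\<^sub>R x) = r *\<^sub>R P t x"
  using qms assms
  by (auto simp: quantum_markov_semigroup_def linear_on_algebra_def simp flip: cscale_of_real)

lemma P_one: "t \<ge> 0 \<Longrightarrow> P t (mat 1) = mat 1"
  using qms by (auto simp: quantum_markov_semigroup_def)

section \<open>Consequences of complete positivity\<close>

lemma P_positive:
  assumes "t \<ge> 0" "x \<in> M" "pos_op x"
  shows "pos_op (P t x)"
proof -
  have "pos_block 1 (\<lambda>i j. x)"
    using assms(3) by (simp add: pos_block_def pos_op_def)
  then have "pos_block 1 (\<lambda>i j. P t x)"
    using qms assms(1,2) by (auto simp: quantum_markov_semigroup_def completely_positive_def)
  then show ?thesis
    by (auto simp: pos_block_def pos_op_def dest: spec[of _ "\<lambda>_. _"])
qed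

text \<open>Complete positivity applied to the positive matrix with rows
  \<open>(a\<^sup>* a, a\<^sup>*)\<close> and \<open>(a, 1)\<close>.\<close>

lemma P_two_positive:
  assumes "t \<ge> 0" "a \<in> M"
  shows "cinner u (P t (adj a ** a) *v u) + cinner u (P t (adj a) *v w)
    + (cinner w (P t a *v u) + cinner w w) \<in> \<real>\<^sub>\<ge>\<^sub>0"
proof -
  define A :: "nat \<Rightarrow> nat \<Rightarrow> complex ^ 'n ^ 'n" where
    "A i j = (if i = 0 then if j = 0 then adj a ** a else adj a
              else if j = 0 then a else mat 1)" for i j
  have two: "(\<Sum>i<2. f i) = f 0 + f (Suc 0)" for f :: "nat \<Rightarrow> complex"
    by (simp add: numeral_2_eq_2)
  have "pos_block 2 A"
    unfolding pos_block_def
  proof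
    fix \<xi> :: "nat \<Rightarrow> complex ^ 'n"
    \<comment> \<open>The quadratic form of \<open>A\<close> is the squared norm of this
      vector.\<close>
    have "cinner (a *v \<xi> 0 + \<xi> 1) (a *v \<xi> 0 + \<xi> 1) \<in> \<real>\<^sub>\<ge>\<^sub>0"
      unfolding cinner_self by (rule nonneg_Reals_of_real_iff[THEN iffD2]) simp
    then show "(\<Sum>i<2. \<Sum>j<2. cinner (\<xi> i) (A i j *v \<xi> j)) \<in> \<real>\<^sub>\<ge>\<^sub>0"
      by (simp add: two A_def cinner_simps cinner_adj[of a] matrix_vector_mul_assoc algebra_simps)
  qed
  moreover have "\<forall>i<2. \<forall>j<2. A i j \<in> M"
    using assms(2) by (simp add: A_def M_closed)
  ultimately have "pos_block 2 (\<lambda>i j. P t (A i j))"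
    using qms assms(1) by (simp add: quantum_markov_semigroup_def completely_positive_def)
  then show ?thesis
    using assms(1)
    by (auto simp: pos_block_def two A_def P_one dest!: spec[of _ "\<lambda>i. if i = 0 then u else w"])
qed

text \<open>A form with real values is Hermitian: comparing the off-diagonal entries of the positive
  2 by 2 block matrix gives the claim.\<close>

lemma P_adj:
  assumes "t \<ge> 0" "a \<in> M"
  shows "P t (adj a) = adj (P t a)"
proof (rule cinner_matrix_eqI)
  fix u w
  let ?z = "\<lambda>w. cinner u (P t (adj a ** a) *v u) + cinner u (P t (adj a) *v w)
    + (cinner w (P t a *v u) + cinner w w)"
  have z: "Im (?z w) = 0" for w
    using P_two_positive[OF assms] by (simp only: complex_nonneg_Reals_iff)
  have zero: "Im (cinner u (P t (adj a ** a) *v u)) = 0"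
    using z[of 0] by (simp add: cinner_def)
  \<comment> \<open>Reality at \<open>w\<close> matches the imaginary parts of the two sides,
    reality at \<open>\<i> *s w\<close> their real parts.\<close>
  have "cinner u (P t (adj a) *v w) = cnj (cinner w (P t a *v u))"
    using z[of w] z[of "\<i> *s w"] zero
    by (simp add: complex_eq_iff cinner_simps vector_scalar_commute cinner_self flip: of_real_power)
  then show "cinner u (P t (adj a) *v w) = cinner u (adj (P t a) *v w)"
    by (simp add: cnj_cinner cinner_adj)
qed

section \<open>Existence and linearity of the generator\<close>

lemma generator_tendsto:
  assumes "x \<in> M"
  shows "((\<lambda>t. (1 / t) *\<^sub>R (x - P t x)) \<longlongrightarrow> L x) (at_right 0)"
proof -
  \<comment> \<open>\<open>generator\<close> is a \<open>Lim\<close>, so its value is informative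
    only once a limit is known to exist.\<close>
  have "\<exists>l. ((\<lambda>t. (1 / t) *\<^sub>R (P t x - x)) \<longlongrightarrow> l) (at_right 0)"
    by (rule continuous_semigroup_differentiable[OF subspace_M])
      (use qms assms in \<open>auto simp: P_linear quantum_markov_semigroup_def\<close>)
  then obtain l where "((\<lambda>t. (1 / t) *\<^sub>R (P t x - x)) \<longlongrightarrow> l) (at_right 0)" ..
  then have "((\<lambda>t. - ((1 / t) *\<^sub>R (P t x - x))) \<longlongrightarrow> - l) (at_right 0)"
    by (rule tendsto_minus)
  then have lim: "((\<lambda>t. (1 / t) *\<^sub>R (x - P t x)) \<longlongrightarrow> - l) (at_right 0)"
    by (simp flip: scaleR_minus_right)
  then have "L x = - l"
    unfolding generator_def by (rule tendsto_Lim[OF trivial_limit_at_right_real])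
  with lim show ?thesis by simp
qed

text \<open>Uniqueness of limits: identities for \<open>P t\<close> pass to \<open>L\<close> by
  computing the limit of a rewritten difference quotient.\<close>

lemma generator_eqI:
  assumes "x \<in> M" "(f \<longlongrightarrow> l) (at_right 0)" "\<And>t. t > 0 \<Longrightarrow> f t = (1 / t) *\<^sub>R (x - P t x)"
  shows "L x = l"
proof -
  have "eventually (\<lambda>t. f t = (1 / t) *\<^sub>R (x - P t x)) (at_right 0)"
    using eventually_at_right_less[of 0] by eventually_elim (simp add: assms(3))
  from tendsto_cong[OF this] assms(2)
  have "((\<lambda>t. (1 / t) *\<^sub>R (x - P t x)) \<longlongrightarrow> l) (at_right 0)"
    by (rule iffD1)
  then show ?thesis
    by (rule tendsto_unique[OF trivial_limit_at_right_real generator_tendsto[OF assms(1)]])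
qed

lemma generator_in:
  assumes "x \<in> M"
  shows "L x \<in> M"
proof (rule Lim_in_closed_set[OF _ _ _ generator_tendsto[OF assms]])
  show "eventually (\<lambda>t. (1 / t) *\<^sub>R (x - P t x) \<in> M) (at_right 0)"
    using eventually_at_right_less[of 0]
    by eventually_elim (simp add: M_scaleR M_diff P_linear assms)
qed (use vna in \<open>auto simp: von_neumann_algebra_def\<close>)

lemma generator_add:
  assumes "x \<in> M" "y \<in> M"
  shows "L (x + y) = L x + L y"
  by (rule generator_eqI[OF _ tendsto_add[OF generator_tendsto generator_tendsto]])
    (use assms in \<open>auto simp: M_closed P_linear algebra_simps\<close>)

lemma generator_cscale:
  assumes "x \<in> M"
  shows "L (cscale c x) = cscale c (L x)"
  by (rule generator_eqI[OF _ bounded_linear.tendsto[OF bounded_linear_cscale generator_tendsto]])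
    (use assms in \<open>auto simp: M_closed P_linear cscale_simps\<close>)

lemma generator_scaleR: "x \<in> M \<Longrightarrow> L (r *\<^sub>R x) = r *\<^sub>R L x"
  using generator_cscale[of x "of_real r"] by (simp add: cscale_of_real)

lemma generator_adj:
  assumes "x \<in> M"
  shows "L (adj x) = adj (L x)"
proof (rule generator_eqI[OF _ bounded_linear.tendsto[OF bounded_linear_adj generator_tendsto[OF assms]]])
  show "adj ((1 / t) *\<^sub>R (x - P t x)) = (1 / t) *\<^sub>R (adj x - P t (adj x))" if "t > 0" for t
    using that assms
    by (simp add: P_adj linear_cmul linear_diff bounded_linear.linear[OF bounded_linear_adj])
qed (use assms in \<open>simp add: M_closed\<close>)

section \<open>Positivity of the form Gamma and the maximum principle\<close>

lemma Gam_in: "a \<in> M \<Longrightarrow> b \<in> M \<Longrightarrow> Gam L a b \<in> M"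
  unfolding Gam_def by (intro M_scaleR M_diff M_closed generator_in)

text \<open>With the test vector \<open>(v, - a v)\<close> in the 2-positivity of \<open>P t\<close> the terms of order \<open>0\<close> in \<open>t\<close>
  cancel, and those of order \<open>1\<close> give \<open>\<Gamma>(a)\<close>.\<close>

lemma Gam_pos:
  assumes "a \<in> M"
  shows "pos_op (Gam L a a)"
  unfolding pos_op_def
proof
  fix v
  define D where "D t x = (1 / t) *\<^sub>R (x - P t x)" for t x
  \<comment> \<open>As \<open>t\<close> tends to 0, \<open>f t\<close> tends to twice the value of
    the form of \<open>Gam L a a\<close> at \<open>v\<close>; for \<open>t > 0\<close> it is the
    2-positivity expression divided by \<open>t\<close>.\<close>
  define f where "f t = cinner v (D t (adj a) *v (a *v v)) + cinner (a *v v) (D t a *v v)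
    - cinner v (D t (adj a ** a) *v v)" for t
  let ?l = "cinner v (L (adj a) *v (a *v v)) + cinner (a *v v) (L a *v v)
    - cinner v (L (adj a ** a) *v v)"
  have "(f \<longlongrightarrow> ?l) (at_right 0)"
    unfolding f_def D_def using assms
    by (intro tendsto_add tendsto_diff bounded_linear.tendsto[OF bounded_linear_form]
        generator_tendsto M_closed)
  moreover have "eventually (\<lambda>t. f t \<in> \<real>\<^sub>\<ge>\<^sub>0) (at_right 0)"
    using eventually_at_right_less[of 0]
  proof eventually_elim
    fix t :: real assume t: "0 < t"
    let ?z = "cinner v (P t (adj a ** a) *v v) + cinner v (P t (adj a) *v - (a *v v))
      + (cinner (- (a *v v)) (P t a *v v) + cinner (- (a *v v)) (- (a *v v)))"
    have minus: "x *v - y = - (x *v y)" for x :: "complex ^ 'n ^ 'n" and y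
      by (simp add: matrix_vector_mult_def vec_eq_iff sum_negf)
    have "?z \<in> \<real>\<^sub>\<ge>\<^sub>0" using t assms by (intro P_two_positive) auto
    moreover have "f t = of_real (1 / t) * ?z"
      by (simp add: f_def D_def form_simps minus cinner_adj[of a] algebra_simps
          flip: matrix_vector_mul_assoc)
    ultimately show "f t \<in> \<real>\<^sub>\<ge>\<^sub>0"
      using t by (metis nonneg_Reals_mult_I nonneg_Reals_of_real_iff[THEN iffD2] less_imp_le zero_less_divide_1_iff)
  qed
  ultimately have "?l \<in> \<real>\<^sub>\<ge>\<^sub>0"
    by (intro Lim_in_closed_set[OF closed_nonneg_Reals_complex _ trivial_limit_at_right_real])
  then have "of_real (1 / 2) * ?l \<in> \<real>\<^sub>\<ge>\<^sub>0"
    by (intro nonneg_Reals_mult_I nonneg_Reals_of_real_iff[THEN iffD2]) auto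
  moreover have "cinner v (Gam L a a *v v) = of_real (1 / 2) * ?l"
    using assms
    by (simp add: Gam_def form_simps generator_adj cinner_adj[of a] algebra_simps
        flip: matrix_vector_mul_assoc)
  ultimately show "cinner v (Gam L a a *v v) \<in> \<real>\<^sub>\<ge>\<^sub>0" by (simp only:)
qed

text \<open>The positive unital map \<open>P t\<close> preserves the bound \<open>C\<close> on the
  form of \<open>x\<close>, which is attained at \<open>v\<close> when \<open>t = 0\<close>. So the
  difference quotients at \<open>v\<close> are nonnegative.\<close>

lemma maximum_principle:
  assumes x: "x \<in> M" "pos_op x"
    and C: "\<And>u. Re (cinner u (x *v u)) \<le> C * (norm u)\<^sup>2" "Re (cinner v (x *v v)) = C * (norm v)\<^sup>2"
  shows "0 \<le> Re (cinner v (L x *v v))"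
proof -
  define y where "y = C *\<^sub>R mat 1 - x"
  have y: "y \<in> M" unfolding y_def by (intro M_diff M_scaleR M_closed x)
  \<comment> \<open>Positivity of \<open>x\<close> supplies the vanishing imaginary part that
    \<open>pos_op\<close> demands.\<close>
  have "pos_op y"
    using C(1) x(2)
    by (simp add: pos_op_def y_def form_simps cinner_self complex_nonneg_Reals_iff flip: of_real_power)
  have "0 \<le> Re (cinner v ((1 / t) *\<^sub>R (x - P t x) *v v))" if "t > 0" for t
  proof -
    have "P t y + P t x = C *\<^sub>R mat 1"
      using P_linear(2)[of t y x] P_linear(4)[of t "mat 1" C] that x y
      by (simp add: y_def P_one M_closed)
    then have "P t y = C *\<^sub>R mat 1 - P t x" by (simp add: algebra_simps)
    moreover have "pos_op (P t y)"
      using that y \<open>pos_op y\<close> by (intro P_positive) auto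
    ultimately have "Re (cinner v (P t x *v v)) \<le> Re (cinner v (x *v v))"
      using C(2) by (auto simp: pos_op_def form_simps cinner_self complex_nonneg_Reals_iff
          simp flip: of_real_power dest!: spec[of _ v])
    then show ?thesis
      using that by (simp add: form_simps divide_right_mono)
  qed
  then have "eventually (\<lambda>t. 0 \<le> Re (cinner v ((1 / t) *\<^sub>R (x - P t x) *v v))) (at_right 0)"
    using eventually_at_right_less[of 0] by (rule eventually_mono[rotated])
  moreover have "((\<lambda>t. Re (cinner v ((1 / t) *\<^sub>R (x - P t x) *v v))) \<longlongrightarrow> Re (cinner v (L x *v v)))
      (at_right 0)"
    by (intro tendsto_Re bounded_linear.tendsto[OF bounded_linear_form] generator_tendsto x(1))
  ultimately show ?thesis
    by (intro tendsto_lowerbound[OF _ _ trivial_limit_at_right_real])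
qed

section \<open>The eigenvalue estimate\<close>

lemma Gam_eigenvector:
  assumes "a \<in> M" "L a = cscale \<mu> a"
  shows "Gam L a a = Re \<mu> *\<^sub>R abs_sq a - (1 / 2) *\<^sub>R L (abs_sq a)"
    and "Gam2 L a a = Re \<mu> *\<^sub>R Gam L a a - (1 / 2) *\<^sub>R L (Gam L a a)"
proof -
  \<comment> \<open>The second slot of \<open>Gam\<close> releases \<open>\<mu>\<close>, the first
    its conjugate; together they contribute \<open>2 * Re \<mu>\<close>.\<close>
  have twice: "cscale \<mu> x + cscale (cnj \<mu>) x = (2 * Re \<mu>) *\<^sub>R x" for x :: "complex ^ 'n ^ 'n"
    by (metis cscale_add_left complex_add_cnj cscale_of_real)
  have "adj a ** a \<in> M" using assms(1) by (intro M_closed)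
  show "Gam L a a = Re \<mu> *\<^sub>R abs_sq a - (1 / 2) *\<^sub>R L (abs_sq a)"
    using twice[of "adj a ** a"]
    by (simp add: Gam_def assms(2) cscale_simps abs_sq_def algebra_simps)
  have "Gam L a (cscale \<mu> a) = cscale \<mu> (Gam L a a)"
    using \<open>adj a ** a \<in> M\<close> assms
    by (simp add: Gam_def generator_cscale cscale_simps mult_ac)
  moreover have "Gam L (cscale \<mu> a) a = cscale (cnj \<mu>) (Gam L a a)"
    using \<open>adj a ** a \<in> M\<close> assms
    by (simp add: Gam_def generator_cscale cscale_simps mult_ac)
  ultimately show "Gam2 L a a = Re \<mu> *\<^sub>R Gam L a a - (1 / 2) *\<^sub>R L (Gam L a a)"
    using twice[of "Gam L a a"] by (simp add: Gam2_def assms(2) algebra_simps)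
qed

theorem eigenvalue_bound:
  assumes K: "K > 0" and N: "N > 1" and BE: "BE M P K N"
    and ev: "eigenvalue M L \<mu>" "\<mu> \<noteq> 0"
  shows "Re \<mu> \<ge> K * N / (N - 1)"
proof -
  obtain a where a: "a \<in> M" "a \<noteq> 0" "L a = cscale \<mu> a"
    using ev(1) by (auto simp: eigenvalue_def)
  define r where "r = Re \<mu>"
  define c where "c = (cmod \<mu>)\<^sup>2 / N"
  define m where "m = (K + sqrt (K\<^sup>2 + 4 * c)) / 2"
  define b where "b = abs_sq a"
  define g where "g = Gam L a a"
  define w where "w = g + (m - K) *\<^sub>R b"
  have "c > 0" using ev(2) N by (simp add: c_def)
  \<comment> \<open>As \<open>K > 0\<close>, the left side is \<open>K\<close>, so \<open>m\<close>
    exceeds \<open>(K + K) / 2\<close>.\<close>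
  then have "sqrt (K\<^sup>2) < sqrt (K\<^sup>2 + 4 * c)" by (simp only: real_sqrt_less_iff)
  then have "m > K" using K by (simp add: m_def)
  have m: "m * (m - K) = c"
  proof -
    have "(sqrt (K\<^sup>2 + 4 * c))\<^sup>2 = K\<^sup>2 + 4 * c" using \<open>c > 0\<close> by simp
    then show ?thesis by (simp add: m_def power2_eq_square field_simps)
  qed
  have M: "b \<in> M" "g \<in> M" "w \<in> M"
    using a(1) by (auto simp: b_def g_def w_def abs_sq_def intro!: M_closed M_scaleR Gam_in)
  have b_form: "cinner v (b *v v) = of_real ((norm (a *v v))\<^sup>2)" for v
    using cinner_self[of "a *v v"]
    by (simp add: b_def abs_sq_def cinner_adj matrix_vector_mul_assoc)
  have g_form: "cinner v (g *v v) \<in> \<real>\<^sub>\<ge>\<^sub>0" for v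
    using Gam_pos[OF a(1)] by (simp add: g_def pos_op_def)
  have w_form: "cinner v (w *v v) = cinner v (g *v v) + of_real ((m - K) * (norm (a *v v))\<^sup>2)" for v
    by (simp add: w_def form_simps b_form algebra_simps)
  have "pos_op w"
    using g_form \<open>m > K\<close> unfolding pos_op_def w_form
    by (intro allI nonneg_Reals_add_I nonneg_Reals_of_real_iff[THEN iffD2]) auto
  have Lb: "L b = 2 *\<^sub>R (r *\<^sub>R b - g)"
    using Gam_eigenvector(1)[OF a(1,3)] by (simp add: g_def b_def r_def)
  have abs_La: "abs_sq (L a) = (cmod \<mu>)\<^sup>2 *\<^sub>R b"
    using complex_norm_square[of \<mu>]
    by (simp add: a(3) abs_sq_def b_def cscale_simps flip: cscale_of_real)
  have Lg: "Re (cinner v (L g *v v))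
      \<le> 2 * ((r - K) * Re (cinner v (g *v v)) - c * Re (cinner v (b *v v)))" for v
  proof -
    have "K *\<^sub>R g + c *\<^sub>R b \<preceq> r *\<^sub>R g - (1 / 2) *\<^sub>R L g"
      using BE a(1) Gam_eigenvector(2)[OF a(1,3)] abs_La
      by (auto simp: BE_def Let_def g_def r_def c_def)
    then show ?thesis
      by (auto simp: op_le_def pos_op_def form_simps complex_nonneg_Reals_iff algebra_simps
          dest!: spec[of _ v])
  qed
  \<comment> \<open>The upper bound for \<open>L w\<close> has coefficients
    \<open>2 * (r - m)\<close> at \<open>g\<close> and \<open>2 * ((m - K) * r - c)\<close> at
    \<open>b\<close>. The choice \<open>c = m * (m - K)\<close> turns the latter into
    \<open>2 * (r - m) * (m - K)\<close>, giving a multiple of \<open>w\<close>.\<close>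
  have Lw: "Re (cinner v (L w *v v)) \<le> 2 * (r - m) * Re (cinner v (w *v v))" for v
  proof -
    have eq: "L w = L g + (m - K) *\<^sub>R L b"
      using M by (simp add: w_def generator_add generator_scaleR M_scaleR)
    have "Re (cinner v (L w *v v)) = Re (cinner v (L g *v v))
        + (m - K) * (2 * (r * Re (cinner v (b *v v)) - Re (cinner v (g *v v))))"
      by (simp add: eq Lb form_simps algebra_simps)
    also have "\<dots> \<le> 2 * (r - m) * Re (cinner v (w *v v))"
      using Lg[of v] by (simp add: w_def form_simps algebra_simps flip: m)
    finally show ?thesis .
  qed
  obtain v where v: "norm v = 1"
      "\<And>u. Re (cinner u (w *v u)) \<le> Re (cinner v (w *v v)) * (norm u)\<^sup>2"
    using form_attains_max by blast
  \<comment> \<open>A vector not killed by \<open>a\<close> makes the form of \<open>w\<close>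
    positive, since \<open>m > K\<close>; hence its maximum is positive too.\<close>
  obtain u where "a *v u \<noteq> 0"
    using a(2) by (auto simp: matrix_eq)
  then have "0 < Re (cinner u (w *v u))"
    using g_form[of u] \<open>m > K\<close>
    by (auto simp: w_form complex_nonneg_Reals_iff intro!: add_nonneg_pos mult_pos_pos)
  then have "0 < Re (cinner v (w *v v))"
    using v(2)[of u] by (smt (verit) mult_nonpos_nonneg zero_le_power2)
  moreover have "0 \<le> Re (cinner v (L w *v v))"
    using M(3) \<open>pos_op w\<close> v by (intro maximum_principle) auto
  \<comment> \<open>If \<open>r < m\<close>, \<open>Lw\<close> would make the form of
    \<open>L w\<close> negative at the maximizer \<open>v\<close>.\<close>
  ultimately have "r \<ge> m"
    using Lw[of v] by (smt (verit) mult_neg_pos)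
  then have "r > 0" using \<open>m > K\<close> K by simp
  have "r * r / N \<le> c"
    using abs_Re_le_cmod[of \<mu>] N \<open>r > 0\<close>
    unfolding c_def r_def power2_eq_square by (intro divide_right_mono mult_mono) auto
  \<comment> \<open>Both factors of \<open>m * (m - K)\<close> are positive and grow when
    \<open>m\<close> is replaced by \<open>r\<close>.\<close>
  also have "c \<le> r * (r - K)"
    unfolding m[symmetric] using \<open>r \<ge> m\<close> \<open>m > K\<close> K by (intro mult_mono) auto
  finally have "r / N \<le> r - K"
    using \<open>r > 0\<close> by (simp flip: times_divide_eq_right)
  then show ?thesis
    using N by (simp add: r_def field_simps)
qed

end

theorem proposition3p8:
  fixes M :: "(complex ^ 'n ^ 'n) set"
    and \<tau> :: "complex ^ 'n ^ 'n \<Rightarrow> complex"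
    and P :: "real \<Rightarrow> complex ^ 'n ^ 'n \<Rightarrow> complex ^ 'n ^ 'n"
    and K N :: real
    and lambda1 :: complex
  assumes "von_neumann_algebra M"
    and "faithful_tracial_state M \<tau>"
    and "quantum_markov_semigroup M P"
    and "K > 0"
    and "N > 1"
    and "BE M P K N"
    and "smallest_nonzero_eigenvalue M (generator P) lambda1"
  shows "Re lambda1 \<ge> K * N / (N - 1)"
proof -
  interpret qms M P using assms(1,3) by unfold_locales
  show ?thesis
    using assms(4-7) eigenvalue_bound by (simp add: smallest_nonzero_eigenvalue_def)
qed

end
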